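(* Let $Y^T,Y^C$ be real random variables with finite second moments, $D\in\{0,1\}$ a random variable, $Y=DY^T+(1-D)Y^C$, and let $X=(I,U,C)$ be a random vector of covariates. Assume: (i) (unconfoundedness) $(Y^T,Y^C)\perp D\mid X$; (ii) (overlap) $0<p(X)<1$ almost surely, where $p(X)=\mathbf{P}(D=1\mid X)$; (iii) $I\perp (U,C)$ and the joint law of $(Y,D,I,U,C)$ factorizes as $p(Y,D,I,U,C)=p(I)\,p(U,C)\,p(D\mid I,U)\,p(Y\mid D,U,C)$. Let $X_0=(I,U)$ and $\beta=\mathbf{E}Y^T-\mathbf{E}Y^C$. Then the semi-parametric efficiency bound for estimating $\beta$ becomes smaller (weakly) after including $C$ in the covariates, i.e. $$\mathbf{E}\left[\frac{\sigma_T^2(X_0)}{p(X_0)}+\frac{\sigma_C^2(X_0)}{1-p(X_0)}+(\beta(X_0)-\beta)^2\right]\ \ge\ \mathbf{E}\left[\frac{\sigma_T^2(X)}{p(X)}+\frac{\sigma_C^2(X)}{1-p(X)}+(\beta(X)-\beta)^2\right].$$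
   Context: Notation: $\perp$ denotes (conditional) independence. For a random vector $Z$ of covariates ($Z=X$ or $Z=X_0$): $p(Z)=\mathbf{P}(D=1\mid Z)$, $\beta_T(Z)=\mathbf{E}[Y^T\mid Z]$, $\beta_C(Z)=\mathbf{E}[Y^C\mid Z]$, $\beta(Z)=\beta_T(Z)-\beta_C(Z)$, $\sigma_T^2(Z)=\mathbf{var}(Y^T\mid Z)$, $\sigma_C^2(Z)=\mathbf{var}(Y^C\mid Z)$. The semi-parametric efficiency bound for $\beta$ with covariates $Z$ is by definition here the quantity $\mathbf{E}[\sigma_T^2(Z)/p(Z)+\sigma_C^2(Z)/(1-p(Z))+(\beta(Z)-\beta)^2]$. Expectations of nonnegative quantities are allowed to take values in $[0,\infty]$. In the factorization, lower-case $p(\cdot)$ of several variables denotes joint/conditional densities with respect to a product of $\sigma$-finite measures. *)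

theory Defs
  imports "HOL-Probability.Probability"
begin

text \<open>
  Throughout, \<open>M\<close> is the underlying probability space and \<open>Z\<close> a random element with values
  in the measurable space \<open>N\<close>. The functions below pick one version of each conditional quantity;
  two versions differ only on a null set.
\<close>

definition cond_exp_given :: "'w measure \<Rightarrow> 'z measure \<Rightarrow> ('w \<Rightarrow> 'z) \<Rightarrow> ('w \<Rightarrow> real) \<Rightarrow> 'w \<Rightarrow> real" where
  "cond_exp_given M N Z f = real_cond_exp M (vimage_algebra (space M) Z N) f"

definition cond_prob_given :: "'w measure \<Rightarrow> 'z measure \<Rightarrow> ('w \<Rightarrow> 'z) \<Rightarrow> 'w set \<Rightarrow> 'w \<Rightarrow> real" where
  "cond_prob_given M N Z A = cond_exp_given M N Z (indicator A)"

definition cond_var_given :: "'w measure \<Rightarrow> 'z measure \<Rightarrow> ('w \<Rightarrow> 'z) \<Rightarrow> ('w \<Rightarrow> real) \<Rightarrow> 'w \<Rightarrow> real" where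
  "cond_var_given M N Z f =
     cond_exp_given M N Z (\<lambda>\<omega>. (f \<omega> - cond_exp_given M N Z f \<omega>)\<^sup>2)"

text \<open>
  Independence of the generated \<open>\<sigma>\<close>-algebras; the library's \<open>indep_var\<close>
  requires both variables to take values in the same type.
\<close>

definition indep_rv :: "'w measure \<Rightarrow> 'a measure \<Rightarrow> ('w \<Rightarrow> 'a) \<Rightarrow> 'b measure \<Rightarrow> ('w \<Rightarrow> 'b) \<Rightarrow> bool" where
  "indep_rv M S V T W \<longleftrightarrow>
     V \<in> measurable M S \<and> W \<in> measurable M T \<and>
     prob_space.indep_set M (sets (vimage_algebra (space M) V S)) (sets (vimage_algebra (space M) W T))"

definition cond_indep_given ::
  "'w measure \<Rightarrow> 'z measure \<Rightarrow> ('w \<Rightarrow> 'z) \<Rightarrow>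
   'a measure \<Rightarrow> ('w \<Rightarrow> 'a) \<Rightarrow> 'b measure \<Rightarrow> ('w \<Rightarrow> 'b) \<Rightarrow> bool" where
  "cond_indep_given M N Z S V T W \<longleftrightarrow>
     (\<forall>A\<in>sets S. \<forall>B\<in>sets T. AE \<omega> in M.
        cond_prob_given M N Z {x \<in> space M. V x \<in> A \<and> W x \<in> B} \<omega> =
        cond_prob_given M N Z {x \<in> space M. V x \<in> A} \<omega> *
        cond_prob_given M N Z {x \<in> space M. W x \<in> B} \<omega>)"

text \<open>
  \<open>k (v, z)\<close> is a conditional density of \<open>V\<close> at \<open>v\<close> given \<open>Z = z\<close>, with respect to
  the measure \<open>S\<close>: \<open>P(V \<in> A, Z \<in> B)\<close> is the integral over \<open>{Z \<in> B}\<close> of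
  the integral of \<open>k (v, Z)\<close> over \<open>v \<in> A\<close>. If \<open>(V, Z)\<close> has a joint density with
  respect to \<open>S\<close> and a \<open>\<sigma>\<close>-finite measure on \<open>N\<close>, this determines
  \<open>k (v, z)\<close> as joint density over marginal density, almost everywhere where the marginal density
  of \<open>Z\<close> is positive.
\<close>

definition cond_density_given ::
  "'w measure \<Rightarrow> 'z measure \<Rightarrow> ('w \<Rightarrow> 'z) \<Rightarrow> 'a measure \<Rightarrow> ('w \<Rightarrow> 'a) \<Rightarrow> ('a \<times> 'z \<Rightarrow> ennreal) \<Rightarrow> bool" where
  "cond_density_given M N Z S V k \<longleftrightarrow>
     V \<in> measurable M S \<and> Z \<in> measurable M N \<and> k \<in> borel_measurable (S \<Otimes>\<^sub>M N) \<and>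
     (\<forall>A\<in>sets S. \<forall>B\<in>sets N.
        emeasure M {\<omega> \<in> space M. V \<omega> \<in> A \<and> Z \<omega> \<in> B} =
        (\<integral>\<^sup>+\<omega>\<in>{\<omega> \<in> space M. Z \<omega> \<in> B}. (\<integral>\<^sup>+v\<in>A. k (v, Z \<omega>) \<partial>S) \<partial>M))"

definition propensity :: "'w measure \<Rightarrow> 'z measure \<Rightarrow> ('w \<Rightarrow> 'z) \<Rightarrow> ('w \<Rightarrow> real) \<Rightarrow> 'w \<Rightarrow> real" where
  "propensity M N Z D = cond_prob_given M N Z {\<omega> \<in> space M. D \<omega> = 1}"

definition cond_effect ::
  "'w measure \<Rightarrow> 'z measure \<Rightarrow> ('w \<Rightarrow> 'z) \<Rightarrow> ('w \<Rightarrow> real) \<Rightarrow> ('w \<Rightarrow> real) \<Rightarrow> 'w \<Rightarrow> real" where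
  "cond_effect M N Z YT YC \<omega> = cond_exp_given M N Z YT \<omega> - cond_exp_given M N Z YC \<omega>"

text \<open>
  The bound takes values in \<open>[0, \<infinity>]\<close>. Under overlap the real integrand is almost surely
  nonnegative and its denominators are almost surely nonzero, so neither the truncation of negative
  values by \<^const>\<open>ennreal\<close> nor division by zero plays a role.
\<close>

definition efficiency_bound ::
  "'w measure \<Rightarrow> 'z measure \<Rightarrow> ('w \<Rightarrow> 'z) \<Rightarrow> ('w \<Rightarrow> real) \<Rightarrow> ('w \<Rightarrow> real) \<Rightarrow> ('w \<Rightarrow> real) \<Rightarrow> real \<Rightarrow> ennreal" where
  "efficiency_bound M N Z YT YC D b =
     (\<integral>\<^sup>+\<omega>. ennreal
        (cond_var_given M N Z YT \<omega> / propensity M N Z D \<omega>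
         + cond_var_given M N Z YC \<omega> / (1 - propensity M N Z D \<omega>)
         + (cond_effect M N Z YT YC \<omega> - b)\<^sup>2) \<partial>M)"

end

theory Submission
  imports Defs
begin

text \<open>
  The factorization forces the two propensity scores to agree: integrating out \<open>y\<close> gives
  \<open>P(D = 1 | X) = q(I, U) h(U, C)\<close>, where \<open>h(u, c)\<close> is the total mass of
  \<open>p(y | D = 1, u, c)\<close>. This mass is \<open>1\<close> almost surely on \<open>{D = 1}\<close>, hence, by
  overlap, almost surely. So \<open>P(D = 1 | X)\<close> is a function of \<open>X\<^sub>0\<close> and equals
  \<open>P(D = 1 | X\<^sub>0) =: p\<close>.

  With a common \<open>p\<close>, decompose each conditional variance given \<open>X\<^sub>0\<close> through \<open>X\<close>. The
  difference of the two bounds becomes the expectation of \<open>a\<^sup>2 / p + b\<^sup>2 / (1 - p) - (a - b)\<^sup>2\<close>, where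
  \<open>a = \<beta>\<^sub>T(X) - \<beta>\<^sub>T(X\<^sub>0)\<close> and \<open>b = \<beta>\<^sub>C(X) - \<beta>\<^sub>C(X\<^sub>0)\<close>; the integrand
  is nonnegative. Since the weights \<open>1 / p\<close> and \<open>1 / (1 - p)\<close> may be unbounded, the variance
  decompositions are multiplied by the weights only under \<open>[0, \<infinity>]\<close>-valued integrals.
\<close>

section \<open>Elementary inequalities and square integrability\<close>

text \<open>The defect is the square of \<open>(1 - p) * x + p * y\<close> over
  \<open>p * (1 - p)\<close>: Cauchy-Schwarz with weights \<open>p\<close> and \<open>1 - p\<close>.
  Apart from this estimate, the comparison of the two bounds consists of identities.\<close>

lemma square_diff_le_weighted:
  fixes x y p :: real
  assumes "0 < p" "p < 1"
  shows "(x - y)\<^sup>2 \<le> x\<^sup>2 / p + y\<^sup>2 / (1 - p)"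
proof -
  have "x\<^sup>2 / p + y\<^sup>2 / (1 - p) - (x - y)\<^sup>2 = ((1 - p) * x + p * y)\<^sup>2 / (p * (1 - p))"
    using assms by (simp add: field_simps) algebra
  moreover have "0 \<le> ((1 - p) * x + p * y)\<^sup>2 / (p * (1 - p))"
    using assms by simp
  ultimately show ?thesis by linarith
qed

lemma integrable_square_diff:
  fixes f g :: "'a \<Rightarrow> real"
  assumes [measurable]: "f \<in> borel_measurable M" "g \<in> borel_measurable M"
    and "integrable M (\<lambda>x. (f x)\<^sup>2)" "integrable M (\<lambda>x. (g x)\<^sup>2)"
  shows "integrable M (\<lambda>x. (f x - g x)\<^sup>2)"
proof (rule Bochner_Integration.integrable_bound)
  show "integrable M (\<lambda>x. 2 * (f x)\<^sup>2 + 2 * (g x)\<^sup>2)" using assms by auto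
  have "(f x - g x)\<^sup>2 \<le> 2 * (f x)\<^sup>2 + 2 * (g x)\<^sup>2" for x
    using zero_le_power2[of "f x + g x"] by (simp add: power2_eq_square algebra_simps)
  then show "AE x in M. norm ((f x - g x)\<^sup>2) \<le> norm (2 * (f x)\<^sup>2 + 2 * (g x)\<^sup>2)" by auto
qed measurable

lemma integrable_mult_square:
  fixes f g :: "'a \<Rightarrow> real"
  assumes [measurable]: "f \<in> borel_measurable M" "g \<in> borel_measurable M"
    and "integrable M (\<lambda>x. (f x)\<^sup>2)" "integrable M (\<lambda>x. (g x)\<^sup>2)"
  shows "integrable M (\<lambda>x. f x * g x)"
proof (rule Bochner_Integration.integrable_bound)
  show "integrable M (\<lambda>x. (f x)\<^sup>2 + (g x)\<^sup>2)" using assms by auto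
  have "\<bar>f x * g x\<bar> \<le> (f x)\<^sup>2 + (g x)\<^sup>2" for x
    using sum_squares_bound[of "\<bar>f x\<bar>" "\<bar>g x\<bar>"] abs_ge_zero[of "f x * g x"]
    unfolding power2_abs mult.assoc abs_mult[symmetric] by linarith
  then show "AE x in M. norm (f x * g x) \<le> norm ((f x)\<^sup>2 + (g x)\<^sup>2)" by auto
qed measurable

section \<open>Variance decompositions with nonnegative weights\<close>

context finite_measure_subalgebra
begin

text \<open>Conditional Jensen for the convex function \<open>x\<^sup>2\<close>; \<open>f\<close>
  itself is integrable because the measure is finite.\<close>

lemma real_cond_exp_square_integrable:
  assumes [measurable]: "f \<in> borel_measurable M" and f2: "integrable M (\<lambda>x. (f x)\<^sup>2)"
  shows "integrable M (\<lambda>x. (real_cond_exp M F f x)\<^sup>2)"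
  by (rule integrable_convex_cond_exp[where q="\<lambda>x. x\<^sup>2" and I=UNIV])
     (use f2 square_integrable_imp_integrable[OF assms] convex_power2 emeasure_finite in auto)

text \<open>Passing through \<open>nn_cond_exp\<close> allows a weight for which the product with
  \<open>h\<close> has infinite integral. Returning to \<open>real_cond_exp\<close> loses nothing,
  since integrability of \<open>h\<close> makes \<open>nn_cond_exp\<close> finite almost
  everywhere.\<close>

lemma nn_integral_mult_real_cond_exp:
  fixes w :: "'a \<Rightarrow> ennreal"
  assumes [measurable]: "w \<in> borel_measurable F" and h: "integrable M h" "\<And>x. 0 \<le> h x"
  shows "(\<integral>\<^sup>+x. w x * ennreal (real_cond_exp M F h x) \<partial>M) = (\<integral>\<^sup>+x. w x * ennreal (h x) \<partial>M)"
proof -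
  have [measurable]: "h \<in> borel_measurable M" using h by auto
  have "(\<integral>\<^sup>+x. nn_cond_exp M F (\<lambda>x. ennreal (h x)) x \<partial>M) = (\<integral>\<^sup>+x. ennreal (h x) \<partial>M)"
    using nn_cond_exp_intg[of "\<lambda>_. 1" "\<lambda>x. ennreal (h x)"] by simp
  also have "\<dots> < \<infinity>"
    using h by (simp add: integrable_iff_bounded)
  finally have "AE x in M. nn_cond_exp M F (\<lambda>x. ennreal (h x)) x \<noteq> \<infinity>"
    by (intro nn_integral_noteq_infinite) auto
  \<comment> \<open>\<open>real_cond_exp\<close> is a difference of two nonnegative parts; the one
    coming from \<open>- h\<close> vanishes.\<close>
  moreover have "AE x in M. nn_cond_exp M F (\<lambda>x. ennreal (- h x)) x = 0"
    using nn_cond_exp_F_meas[of "\<lambda>_. 0"] h(2) by (auto simp: ennreal_neg)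
  ultimately have "AE x in M. ennreal (real_cond_exp M F h x) = nn_cond_exp M F (\<lambda>x. ennreal (h x)) x"
    by eventually_elim (auto simp: real_cond_exp_def less_top)
  then have "(\<integral>\<^sup>+x. w x * ennreal (real_cond_exp M F h x) \<partial>M)
      = (\<integral>\<^sup>+x. w x * nn_cond_exp M F (\<lambda>x. ennreal (h x)) x \<partial>M)"
    by (intro nn_integral_cong_AE) auto
  then show ?thesis
    by (simp add: nn_cond_exp_intg)
qed

text \<open>Conditional Pythagoras. Split \<open>f - g\<close> at
  \<open>real_cond_exp M F f\<close>: in the cross term the \<open>F\<close>-measurable factor pulls
  out, and the remaining residual has conditional expectation zero.\<close>

lemma real_cond_exp_square_diff:
  assumes [measurable]: "f \<in> borel_measurable M" "g \<in> borel_measurable F"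
    and f2: "integrable M (\<lambda>x. (f x)\<^sup>2)" and g2: "integrable M (\<lambda>x. (g x)\<^sup>2)"
  shows "AE x in M. real_cond_exp M F (\<lambda>x. (f x - g x)\<^sup>2) x =
    real_cond_exp M F (\<lambda>x. (f x - real_cond_exp M F f x)\<^sup>2) x + (real_cond_exp M F f x - g x)\<^sup>2"
proof -
  let ?a = "real_cond_exp M F f"
  have [measurable]: "g \<in> borel_measurable M" by (rule measurable_from_subalg[OF subalg]) fact
  have f1: "integrable M f" by (rule square_integrable_imp_integrable) (use f2 in auto)
  have a1: "integrable M ?a" by (rule real_cond_exp_int) (rule f1)
  have a2: "integrable M (\<lambda>x. (?a x)\<^sup>2)" by (rule real_cond_exp_square_integrable) (use f2 in auto)
  have fa2: "integrable M (\<lambda>x. (f x - ?a x)\<^sup>2)" and ag2: "integrable M (\<lambda>x. (?a x - g x)\<^sup>2)"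
    by (rule integrable_square_diff; use f2 g2 a2 in auto)+
  \<comment> \<open>Additivity of \<open>real_cond_exp\<close> requires each summand to be
    integrable; the cross term is a product of two square-integrable factors.\<close>
  have "integrable M (\<lambda>x. (?a x - g x) * (f x - ?a x))"
    by (rule integrable_mult_square) (use fa2 ag2 in auto)
  then have c: "integrable M (\<lambda>x. 2 * (?a x - g x) * (f x - ?a x))"
    unfolding mult.assoc by (rule integrable_mult_right)
  have "AE x in M. real_cond_exp M F (\<lambda>x. 2 * (?a x - g x) * (f x - ?a x)) x
      = 2 * (?a x - g x) * real_cond_exp M F (\<lambda>x. f x - ?a x) x"
    by (rule real_cond_exp_mult) (use c in auto)
  moreover have "AE x in M. real_cond_exp M F (\<lambda>x. f x - ?a x) x = ?a x - real_cond_exp M F ?a x"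
    by (rule real_cond_exp_diff) (use f1 a1 in auto)
  moreover have "AE x in M. real_cond_exp M F ?a x = ?a x"
    by (rule real_cond_exp_F_meas) (use a1 in auto)
  moreover have "AE x in M. real_cond_exp M F (\<lambda>x. (?a x - g x)\<^sup>2) x = (?a x - g x)\<^sup>2"
    by (rule real_cond_exp_F_meas) (use ag2 in auto)
  moreover have "AE x in M. real_cond_exp M F (\<lambda>x. 2 * (?a x - g x) * (f x - ?a x) + (?a x - g x)\<^sup>2) x
      = real_cond_exp M F (\<lambda>x. 2 * (?a x - g x) * (f x - ?a x)) x + real_cond_exp M F (\<lambda>x. (?a x - g x)\<^sup>2) x"
    by (rule real_cond_exp_add) (use c ag2 in auto)
  moreover have "AE x in M.
      real_cond_exp M F (\<lambda>x. (f x - ?a x)\<^sup>2 + (2 * (?a x - g x) * (f x - ?a x) + (?a x - g x)\<^sup>2)) x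
      = real_cond_exp M F (\<lambda>x. (f x - ?a x)\<^sup>2) x
        + real_cond_exp M F (\<lambda>x. 2 * (?a x - g x) * (f x - ?a x) + (?a x - g x)\<^sup>2) x"
    by (rule real_cond_exp_add) (use c ag2 fa2 in auto)
  moreover have "(\<lambda>x. (f x - g x)\<^sup>2)
      = (\<lambda>x. (f x - ?a x)\<^sup>2 + (2 * (?a x - g x) * (f x - ?a x) + (?a x - g x)\<^sup>2))"
    by (rule ext) algebra
  ultimately show ?thesis by auto
qed

text \<open>Both sides may be infinite, so the weight enters only under the integral: the square is
  exchanged for its conditional expectation, split there by the Pythagoras identity, and the
  variance part is exchanged back.\<close>

lemma nn_integral_mult_square_diff:
  fixes w :: "'a \<Rightarrow> ennreal"
  assumes [measurable]: "w \<in> borel_measurable F" "f \<in> borel_measurable M" "g \<in> borel_measurable F"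
    and f2: "integrable M (\<lambda>x. (f x)\<^sup>2)" and g2: "integrable M (\<lambda>x. (g x)\<^sup>2)"
  shows "(\<integral>\<^sup>+x. w x * ennreal ((f x - g x)\<^sup>2) \<partial>M) =
    (\<integral>\<^sup>+x. w x * ennreal ((f x - real_cond_exp M F f x)\<^sup>2) \<partial>M)
    + (\<integral>\<^sup>+x. w x * ennreal ((real_cond_exp M F f x - g x)\<^sup>2) \<partial>M)"
proof -
  let ?a = "real_cond_exp M F f" and ?v = "real_cond_exp M F (\<lambda>x. (f x - real_cond_exp M F f x)\<^sup>2)"
  have [measurable]: "g \<in> borel_measurable M" "w \<in> borel_measurable M"
    by (rule measurable_from_subalg[OF subalg]; fact)+
  have a2: "integrable M (\<lambda>x. (?a x)\<^sup>2)" by (rule real_cond_exp_square_integrable) (use f2 in auto)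
  have fg2: "integrable M (\<lambda>x. (f x - g x)\<^sup>2)" and fa2: "integrable M (\<lambda>x. (f x - ?a x)\<^sup>2)"
    by (rule integrable_square_diff; use f2 g2 a2 in auto)+
  have v: "AE x in M. 0 \<le> ?v x"
    by (rule real_cond_exp_pos) auto
  have "(\<integral>\<^sup>+x. w x * ennreal ((f x - g x)\<^sup>2) \<partial>M)
      = (\<integral>\<^sup>+x. w x * ennreal (real_cond_exp M F (\<lambda>x. (f x - g x)\<^sup>2) x) \<partial>M)"
    by (rule nn_integral_mult_real_cond_exp[symmetric]) (use fg2 in auto)
  also have "\<dots> = (\<integral>\<^sup>+x. w x * ennreal (?v x) + w x * ennreal ((?a x - g x)\<^sup>2) \<partial>M)"
    using real_cond_exp_square_diff[OF assms(2-5)] v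
    by (intro nn_integral_cong_AE, eventually_elim) (simp add: ennreal_plus distrib_left)
  also have "\<dots> = (\<integral>\<^sup>+x. w x * ennreal (?v x) \<partial>M) + (\<integral>\<^sup>+x. w x * ennreal ((?a x - g x)\<^sup>2) \<partial>M)"
    by (rule nn_integral_add) measurable
  also have "(\<integral>\<^sup>+x. w x * ennreal (?v x) \<partial>M) = (\<integral>\<^sup>+x. w x * ennreal ((f x - ?a x)\<^sup>2) \<partial>M)"
    by (rule nn_integral_mult_real_cond_exp) (use fa2 in auto)
  finally show ?thesis .
qed

text \<open>A weighted law of total variance: the previous identity for \<open>F\<close>, centred at
  the conditional expectation given \<open>G\<close>. As \<open>w\<close> is measurable for
  \<open>G\<close>, hence for \<open>F\<close>, both conditional variances can be traded for squared
  residuals.\<close>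

lemma nn_integral_mult_cond_var_refine:
  fixes w :: "'a \<Rightarrow> ennreal"
  assumes G: "subalgebra F G"
    and [measurable]: "w \<in> borel_measurable G" "f \<in> borel_measurable M"
    and f2: "integrable M (\<lambda>x. (f x)\<^sup>2)"
  shows "(\<integral>\<^sup>+x. w x * ennreal (real_cond_exp M G (\<lambda>x. (f x - real_cond_exp M G f x)\<^sup>2) x) \<partial>M) =
    (\<integral>\<^sup>+x. w x * ennreal (real_cond_exp M F (\<lambda>x. (f x - real_cond_exp M F f x)\<^sup>2) x) \<partial>M)
    + (\<integral>\<^sup>+x. w x * ennreal ((real_cond_exp M F f x - real_cond_exp M G f x)\<^sup>2) \<partial>M)"
proof -
  interpret G: finite_measure_subalgebra M G
    using G subalg by unfold_locales (auto simp: subalgebra_def)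
  let ?a = "real_cond_exp M F f" and ?b = "real_cond_exp M G f"
  have [measurable]: "w \<in> borel_measurable F" "?b \<in> borel_measurable F"
    by (rule measurable_from_subalg[OF G]; simp)+
  have a2: "integrable M (\<lambda>x. (?a x)\<^sup>2)" by (rule real_cond_exp_square_integrable) (use f2 in auto)
  have b2: "integrable M (\<lambda>x. (?b x)\<^sup>2)" by (rule G.real_cond_exp_square_integrable) (use f2 in auto)
  have "integrable M (\<lambda>x. (f x - ?a x)\<^sup>2)" "integrable M (\<lambda>x. (f x - ?b x)\<^sup>2)"
    by (rule integrable_square_diff; use f2 a2 b2 in auto)+
  then show ?thesis
    using nn_integral_mult_square_diff[of w f ?b] f2 b2
    by (simp add: G.nn_integral_mult_real_cond_exp nn_integral_mult_real_cond_exp)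
qed

text \<open>After refinement of the variances, the \<open>G\<close> bound contains the
  \<open>F\<close> variance terms plus weighted squares of the changes in the two conditional means.
  These squares dominate the extra spread of the conditional effect given \<open>F\<close> around
  its value given \<open>G\<close>.\<close>

lemma nn_integral_efficiency_bound_mono:
  assumes G: "subalgebra F G"
    and [measurable]: "f \<in> borel_measurable M" "g \<in> borel_measurable M"
    and f2: "integrable M (\<lambda>x. (f x)\<^sup>2)" and g2: "integrable M (\<lambda>x. (g x)\<^sup>2)"
    and [measurable]: "p \<in> borel_measurable G"
    and p: "AE x in M. 0 < p x \<and> p x < 1"
  shows "(\<integral>\<^sup>+x. ennreal
        (real_cond_exp M F (\<lambda>x. (f x - real_cond_exp M F f x)\<^sup>2) x / p x
         + real_cond_exp M F (\<lambda>x. (g x - real_cond_exp M F g x)\<^sup>2) x / (1 - p x)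
         + (real_cond_exp M F f x - real_cond_exp M F g x - b)\<^sup>2) \<partial>M)
     \<le> (\<integral>\<^sup>+x. ennreal
        (real_cond_exp M G (\<lambda>x. (f x - real_cond_exp M G f x)\<^sup>2) x / p x
         + real_cond_exp M G (\<lambda>x. (g x - real_cond_exp M G g x)\<^sup>2) x / (1 - p x)
         + (real_cond_exp M G f x - real_cond_exp M G g x - b)\<^sup>2) \<partial>M)"
proof -
  interpret G: finite_measure_subalgebra M G
    using G subalg by unfold_locales (auto simp: subalgebra_def)
  have [measurable]: "p \<in> borel_measurable M"
    by (rule measurable_from_subalg[OF G.subalg]) fact
  let ?var = "\<lambda>H h. real_cond_exp M H (\<lambda>x. (h x - real_cond_exp M H h x)\<^sup>2)"
  define w where "w x = ennreal (1 / p x)" for x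
  define w' where "w' x = ennreal (1 / (1 - p x))" for x
  have [measurable]: "w \<in> borel_measurable G" "w' \<in> borel_measurable G"
    "w \<in> borel_measurable M" "w' \<in> borel_measurable M"
    unfolding w_def w'_def by measurable
  \<comment> \<open>Used below with \<open>H\<close> equal to \<open>F\<close> and to
    \<open>G\<close>. Nonnegativity of the conditional variances and of the weights lets
    \<open>ennreal\<close> distribute over the sum.\<close>
  have split: "(\<integral>\<^sup>+x. ennreal (?var H f x / p x + ?var H g x / (1 - p x)
        + (real_cond_exp M H f x - real_cond_exp M H g x - b)\<^sup>2) \<partial>M)
      = (\<integral>\<^sup>+x. w x * ennreal (?var H f x) \<partial>M) + (\<integral>\<^sup>+x. w' x * ennreal (?var H g x) \<partial>M)
        + (\<integral>\<^sup>+x. ennreal ((real_cond_exp M H f x - real_cond_exp M H g x - b)\<^sup>2) \<partial>M)"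
    if "finite_measure_subalgebra M H" for H
  proof -
    interpret H: finite_measure_subalgebra M H by fact
    have "AE x in M. 0 \<le> ?var H f x" "AE x in M. 0 \<le> ?var H g x"
      by (rule H.real_cond_exp_pos; simp)+
    with p have "AE x in M. ennreal (?var H f x / p x + ?var H g x / (1 - p x)
          + (real_cond_exp M H f x - real_cond_exp M H g x - b)\<^sup>2)
        = w x * ennreal (?var H f x) + w' x * ennreal (?var H g x)
          + ennreal ((real_cond_exp M H f x - real_cond_exp M H g x - b)\<^sup>2)"
      by eventually_elim (simp add: w_def w'_def ennreal_plus ennreal_mult'[symmetric])
    then show ?thesis
      by (simp add: nn_integral_cong_AE nn_integral_add)
  qed
  let ?d = "\<lambda>H x. real_cond_exp M H f x - real_cond_exp M H g x - b"
  have const: "integrable M (\<lambda>x. b\<^sup>2)" by simp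
  have f1: "integrable M f" and g1: "integrable M g"
    by (rule square_integrable_imp_integrable; use f2 g2 in auto)+
  have F2: "integrable M (\<lambda>x. (real_cond_exp M F f x)\<^sup>2)" "integrable M (\<lambda>x. (real_cond_exp M F g x)\<^sup>2)"
    by (rule real_cond_exp_square_integrable; use f2 g2 in auto)+
  have d2: "integrable M (\<lambda>x. (?d F x)\<^sup>2)"
    using F2 const by (intro integrable_square_diff) auto
  have F1: "integrable M (real_cond_exp M F f)" "integrable M (real_cond_exp M F g)"
    using f1 g1 by auto
  \<comment> \<open>Linearity and the tower property will give that the centred effect
    \<open>?d F\<close> has conditional expectation \<open>?d G\<close> given
    \<open>G\<close>.\<close>
  have "AE x in M. real_cond_exp M G (?d F) x
      = real_cond_exp M G (\<lambda>x. real_cond_exp M F f x - real_cond_exp M F g x) x - real_cond_exp M G (\<lambda>_. b) x"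
    using F1 by (intro G.real_cond_exp_diff) auto
  moreover have "AE x in M. real_cond_exp M G (\<lambda>x. real_cond_exp M F f x - real_cond_exp M F g x) x
      = real_cond_exp M G (real_cond_exp M F f) x - real_cond_exp M G (real_cond_exp M F g) x"
    using F1 by (intro G.real_cond_exp_diff) auto
  moreover have "AE x in M. real_cond_exp M G (\<lambda>_. b) x = b"
    by (rule G.real_cond_exp_F_meas) auto
  moreover have "AE x in M. real_cond_exp M G (real_cond_exp M F f) x = real_cond_exp M G f x"
    "AE x in M. real_cond_exp M G (real_cond_exp M F g) x = real_cond_exp M G g x"
    using f1 g1 by (auto intro!: G.real_cond_exp_nested_subalg[OF subalg G])
  ultimately have dG: "AE x in M. real_cond_exp M G (?d F) x = ?d G x"
    by eventually_elim simp
  \<comment> \<open>Pythagoras given \<open>G\<close> with weight 1 and centre 0: the mean square of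
    \<open>?d F\<close> is its spread around \<open>?d G\<close> plus the mean square of
    \<open>?d G\<close>.\<close>
  have "(\<integral>\<^sup>+x. ennreal ((?d F x)\<^sup>2) \<partial>M)
      = (\<integral>\<^sup>+x. ennreal ((?d F x - real_cond_exp M G (?d F) x)\<^sup>2) \<partial>M)
        + (\<integral>\<^sup>+x. ennreal ((real_cond_exp M G (?d F) x)\<^sup>2) \<partial>M)"
    using G.nn_integral_mult_square_diff[of "\<lambda>_. 1" "?d F" "\<lambda>_. 0"] d2 by simp
  also have "(\<integral>\<^sup>+x. ennreal ((?d F x - real_cond_exp M G (?d F) x)\<^sup>2) \<partial>M)
      \<le> (\<integral>\<^sup>+x. w x * ennreal ((real_cond_exp M F f x - real_cond_exp M G f x)\<^sup>2)
          + w' x * ennreal ((real_cond_exp M F g x - real_cond_exp M G g x)\<^sup>2) \<partial>M)"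
    (is "_ \<le> (\<integral>\<^sup>+x. w x * ?s x + w' x * ?t x \<partial>M)")
  proof (rule nn_integral_mono_AE)
    show "AE x in M. ennreal ((?d F x - real_cond_exp M G (?d F) x)\<^sup>2) \<le> w x * ?s x + w' x * ?t x"
      using p dG
    proof eventually_elim
      case (elim x)
      let ?x = "real_cond_exp M F f x - real_cond_exp M G f x"
        and ?y = "real_cond_exp M F g x - real_cond_exp M G g x"
      have "?d F x - real_cond_exp M G (?d F) x = ?x - ?y" using elim by simp
      moreover have "ennreal ((?x - ?y)\<^sup>2) \<le> ennreal (?x\<^sup>2 / p x + ?y\<^sup>2 / (1 - p x))"
        using elim by (intro ennreal_leI square_diff_le_weighted) auto
      moreover have "ennreal (?x\<^sup>2 / p x + ?y\<^sup>2 / (1 - p x)) = w x * ?s x + w' x * ?t x"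
        using elim by (simp add: w_def w'_def ennreal_plus ennreal_mult'[symmetric])
      ultimately show ?case by (simp only:)
    qed
  qed
  also have "(\<integral>\<^sup>+x. w x * ?s x + w' x * ?t x \<partial>M) = (\<integral>\<^sup>+x. w x * ?s x \<partial>M) + (\<integral>\<^sup>+x. w' x * ?t x \<partial>M)"
    by (rule nn_integral_add) measurable
  also have "(\<integral>\<^sup>+x. ennreal ((real_cond_exp M G (?d F) x)\<^sup>2) \<partial>M) = (\<integral>\<^sup>+x. ennreal ((?d G x)\<^sup>2) \<partial>M)"
    using dG by (intro nn_integral_cong_AE) auto
  finally have d: "(\<integral>\<^sup>+x. ennreal ((?d F x)\<^sup>2) \<partial>M)
      \<le> (\<integral>\<^sup>+x. w x * ?s x \<partial>M) + (\<integral>\<^sup>+x. w' x * ?t x \<partial>M) + (\<integral>\<^sup>+x. ennreal ((?d G x)\<^sup>2) \<partial>M)"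
    by (simp add: add_right_mono)
  \<comment> \<open>Once the variances given \<open>G\<close> are refined, the variance terms given
    \<open>F\<close> stand on both sides, and adding them to \<open>d\<close> is all that
    remains.\<close>
  show ?thesis
    unfolding split[OF finite_measure_subalgebra_axioms] split[OF G.finite_measure_subalgebra_axioms]
      nn_integral_mult_cond_var_refine[OF G \<open>w \<in> borel_measurable G\<close> \<open>f \<in> borel_measurable M\<close> f2]
      nn_integral_mult_cond_var_refine[OF G \<open>w' \<in> borel_measurable G\<close> \<open>g \<in> borel_measurable M\<close> g2]
    using add_left_mono[OF d] by (simp add: ac_simps)
qed

end

section \<open>Sigma-algebras generated by random elements\<close>

lemma subalgebra_vimage_algebra:
  assumes "Z \<in> measurable M N"
  shows "subalgebra M (vimage_algebra (space M) Z N)"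
  using sets_image_in_sets[OF refl assms] by (simp add: subalgebra_def)

lemma measurable_vimage_algebra_comp:
  assumes "Z \<in> measurable M N" "f \<in> measurable N L"
  shows "(\<lambda>x. f (Z x)) \<in> measurable (vimage_algebra (space M) Z N) L"
  using assms(1) measurable_compose[OF measurable_vimage_algebra1 assms(2), of Z "space M"]
  by (auto dest: measurable_space)

lemma subalgebra_vimage_algebra_comp:
  assumes "Z \<in> measurable M N" "T \<in> measurable N L" "\<And>x. x \<in> space M \<Longrightarrow> W x = T (Z x)"
  shows "subalgebra (vimage_algebra (space M) Z N) (vimage_algebra (space M) W L)"
proof -
  have "W \<in> measurable (vimage_algebra (space M) Z N) L"
    by (subst measurable_cong[where g="\<lambda>x. T (Z x)"]) (auto simp: assms(3) intro: measurable_vimage_algebra_comp[OF assms(1,2)])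
  then show ?thesis
    using sets_image_in_sets[OF refl, of W "vimage_algebra (space M) Z N" L] by (simp add: subalgebra_def)
qed

lemma sets_vimage_algebraE:
  assumes "A \<in> sets (vimage_algebra (space M) Z N)" "Z \<in> measurable M N"
  obtains B where "B \<in> sets N" "A = {x \<in> space M. Z x \<in> B}"
proof -
  have "A \<in> {Z -` B \<inter> space M |B. B \<in> sets N}"
    using assms by (subst (asm) sets_vimage_algebra2) (auto dest: measurable_space)
  then show ?thesis
    using that by auto
qed

section \<open>Conditional probabilities and densities\<close>

text \<open>Uniqueness of \<open>nn_cond_exp\<close> identifies \<open>g\<close>, and the negative
  part of an indicator contributes zero. This reads a conditional probability off a
  \<open>[0, \<infinity>]\<close>-valued integral formula.\<close>

lemma (in sigma_finite_subalgebra) real_cond_exp_indicator_eq: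
  assumes A: "A \<in> sets M" and g: "g \<in> borel_measurable F"
    and eq: "\<And>B. B \<in> sets F \<Longrightarrow> emeasure M (A \<inter> B) = (\<integral>\<^sup>+x\<in>B. g x \<partial>M)"
  shows "AE x in M. real_cond_exp M F (indicator A) x = enn2real (g x)"
proof -
  have "AE x in M. g x = nn_cond_exp M F (indicator A) x"
  proof (rule nn_cond_exp_charact)
    fix B assume B: "B \<in> sets F"
    then have "B \<in> sets M" using subalg by (auto simp: subalgebra_def)
    with A B show "(\<integral>\<^sup>+x\<in>B. indicator A x \<partial>M) = (\<integral>\<^sup>+x\<in>B. g x \<partial>M)"
      by (simp add: eq[symmetric] indicator_inter_arith[symmetric])
  qed (use A g in auto)
  moreover have "AE x in M. nn_cond_exp M F (\<lambda>x. ennreal (- indicator A x)) x = 0"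
    using nn_cond_exp_F_meas[of "\<lambda>_. 0"] by (auto simp: ennreal_neg)
  moreover have "(\<lambda>x. ennreal (indicator A x)) = indicator A"
    by (auto simp: indicator_def)
  ultimately show ?thesis
    by (auto simp: real_cond_exp_def)
qed

text \<open>Taking \<open>A\<close> to be the whole of \<open>space S\<close> in the defining
  equation, the total mass at \<open>Z\<close> and the constant 1 have equal integrals over every
  event generated by \<open>Z\<close>. Both are therefore versions of the same conditional
  expectation.\<close>

lemma AE_cond_density_given_nn_integral:
  assumes "prob_space M" and S: "sigma_finite_measure S" and k: "cond_density_given M N Z S V k"
  shows "AE \<omega> in M. (\<integral>\<^sup>+v. k (v, Z \<omega>) \<partial>S) = 1"
proof -
  interpret prob_space M by fact
  interpret S: sigma_finite_measure S by fact
  have V [measurable]: "V \<in> measurable M S" and Z [measurable]: "Z \<in> measurable M N"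
    and [measurable]: "k \<in> borel_measurable (S \<Otimes>\<^sub>M N)"
    and eq: "\<And>A B. A \<in> sets S \<Longrightarrow> B \<in> sets N \<Longrightarrow> emeasure M {\<omega> \<in> space M. V \<omega> \<in> A \<and> Z \<omega> \<in> B} =
        (\<integral>\<^sup>+\<omega>\<in>{\<omega> \<in> space M. Z \<omega> \<in> B}. (\<integral>\<^sup>+v\<in>A. k (v, Z \<omega>) \<partial>S) \<partial>M)"
    using k by (auto simp: cond_density_given_def)
  let ?F = "vimage_algebra (space M) Z N"
  interpret finite_measure_subalgebra M ?F
    by unfold_locales (rule subalgebra_vimage_algebra[OF Z])
  define h where "h z = (\<integral>\<^sup>+v. k (v, z) \<partial>S)" for z
  have h [measurable]: "h \<in> borel_measurable N" unfolding h_def by measurable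
  have "AE \<omega> in M. h (Z \<omega>) = nn_cond_exp M ?F (\<lambda>_. 1) \<omega>"
  proof (rule nn_cond_exp_charact)
    fix A assume "A \<in> sets ?F"
    then obtain B where B: "B \<in> sets N" and A: "A = {\<omega> \<in> space M. Z \<omega> \<in> B}"
      using Z by (rule sets_vimage_algebraE)
    have "{\<omega> \<in> space M. V \<omega> \<in> space S \<and> Z \<omega> \<in> B} = A"
      using measurable_space[OF V] by (auto simp: A)
    moreover have "(\<integral>\<^sup>+v\<in>space S. k (v, z) \<partial>S) = h z" for z
      unfolding h_def by (rule nn_integral_cong) simp
    moreover have "A \<in> sets M" unfolding A using B by measurable
    ultimately show "(\<integral>\<^sup>+\<omega>\<in>A. 1 \<partial>M) = (\<integral>\<^sup>+\<omega>\<in>A. h (Z \<omega>) \<partial>M)"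
      using eq[OF sets.top B] by (simp add: A[symmetric])
  qed (auto intro: measurable_vimage_algebra_comp[OF Z h])
  moreover have "AE \<omega> in M. (1::ennreal) = nn_cond_exp M ?F (\<lambda>_. 1) \<omega>"
    by (rule nn_cond_exp_F_meas) simp
  ultimately show ?thesis
    unfolding h_def by eventually_elim simp
qed

text \<open>The joint law and the product of the marginal laws agree on rectangles, hence
  everywhere. This supplies the density of the full covariate vector.\<close>

lemma distributed_Pair_indep_rv:
  assumes "prob_space M" and S: "sigma_finite_measure S" and T: "sigma_finite_measure T"
    and V: "distributed M S V f" and W: "distributed M T W g"
    and indep: "indep_rv M S V T W"
  shows "distributed M (S \<Otimes>\<^sub>M T) (\<lambda>\<omega>. (V \<omega>, W \<omega>)) (\<lambda>(x, y). f x * g y)"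
proof -
  interpret prob_space M by fact
  have [measurable]: "V \<in> measurable M S" "W \<in> measurable M T"
    using V W by (auto simp: distributed_def)
  interpret V: prob_space "distr M S V" by (rule prob_space_distr) simp
  interpret W: prob_space "distr M T W" by (rule prob_space_distr) simp
  have "distr M S V \<Otimes>\<^sub>M distr M T W = distr M (S \<Otimes>\<^sub>M T) (\<lambda>\<omega>. (V \<omega>, W \<omega>))"
  proof (rule pair_measure_eqI)
    fix A B assume "A \<in> sets (distr M S V)" "B \<in> sets (distr M T W)"
    then have [measurable]: "A \<in> sets S" "B \<in> sets T" by auto
    have "V -` A \<inter> space M \<in> sets (vimage_algebra (space M) V S)"
      "W -` B \<inter> space M \<in> sets (vimage_algebra (space M) W T)"
      by (auto intro: in_vimage_algebra)
    with indep have "prob ((V -` A \<inter> space M) \<inter> (W -` B \<inter> space M))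
        = prob (V -` A \<inter> space M) * prob (W -` B \<inter> space M)"
      by (intro indep_setD) (auto simp: indep_rv_def)
    moreover have "(\<lambda>\<omega>. (V \<omega>, W \<omega>)) -` (A \<times> B) \<inter> space M = (V -` A \<inter> space M) \<inter> (W -` B \<inter> space M)"
      by auto
    ultimately show "emeasure (distr M S V) A * emeasure (distr M T W) B
        = emeasure (distr M (S \<Otimes>\<^sub>M T) (\<lambda>\<omega>. (V \<omega>, W \<omega>))) (A \<times> B)"
      by (simp add: emeasure_distr emeasure_eq_measure ennreal_mult'')
  qed (auto intro: V.sigma_finite_measure_axioms W.sigma_finite_measure_axioms cong: sets_pair_measure_cong)
  then show ?thesis
    by (rule distributed_joint_indep'[OF S T V W])
qed

text \<open>Integrate the joint density over a box, first in \<open>v\<close>, then in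
  \<open>w\<close>, then in \<open>x\<close>. The marginal density \<open>r\<close> is absorbed into
  the law of \<open>X\<close>, so no division by it occurs. \<open>T\<close> need not be counting
  measure, hence the atom mass \<open>emeasure T {d}\<close>.\<close>

lemma emeasure_factorized_density:
  assumes "sigma_finite_measure S" "sigma_finite_measure T" "sigma_finite_measure R"
    and VWX: "distributed M (S \<Otimes>\<^sub>M (T \<Otimes>\<^sub>M R)) (\<lambda>\<omega>. (V \<omega>, W \<omega>, X \<omega>))
      (\<lambda>(v, w, x). r x * a (w, x) * k (v, w, x))"
    and X: "distributed M R X r"
    and [measurable]: "a \<in> borel_measurable (T \<Otimes>\<^sub>M R)" "k \<in> borel_measurable (S \<Otimes>\<^sub>M (T \<Otimes>\<^sub>M R))"
    and d: "{d} \<in> sets T" and B: "B \<in> sets R"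
  shows "emeasure M {\<omega> \<in> space M. W \<omega> = d \<and> X \<omega> \<in> B} =
    (\<integral>\<^sup>+\<omega>\<in>{\<omega> \<in> space M. X \<omega> \<in> B}. a (d, X \<omega>) * emeasure T {d} * (\<integral>\<^sup>+v. k (v, d, X \<omega>) \<partial>S) \<partial>M)"
proof -
  interpret S: sigma_finite_measure S by fact
  interpret T: sigma_finite_measure T by fact
  interpret R: sigma_finite_measure R by fact
  interpret TR: pair_sigma_finite T R ..
  interpret STR: pair_sigma_finite S "T \<Otimes>\<^sub>M R" ..
  note [measurable] = d B
  have [measurable]: "X \<in> measurable M R" "r \<in> borel_measurable R"
    "(\<lambda>\<omega>. (V \<omega>, W \<omega>, X \<omega>)) \<in> measurable M (S \<Otimes>\<^sub>M (T \<Otimes>\<^sub>M R))"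
    using VWX X by (auto simp: distributed_def)
  have [measurable]: "d \<in> space T" using sets.sets_into_space[OF d] by auto
  define h where "h z = (\<integral>\<^sup>+v. k (v, z) \<partial>S)" for z
  have [measurable]: "h \<in> borel_measurable (T \<Otimes>\<^sub>M R)" unfolding h_def by measurable
  let ?E = "space S \<times> {d} \<times> B"
  have E: "?E \<in> sets (S \<Otimes>\<^sub>M (T \<Otimes>\<^sub>M R))" by measurable
  have "{\<omega> \<in> space M. W \<omega> = d \<and> X \<omega> \<in> B} = (\<lambda>\<omega>. (V \<omega>, W \<omega>, X \<omega>)) -` ?E \<inter> space M"
    using measurable_space[OF \<open>(\<lambda>\<omega>. (V \<omega>, W \<omega>, X \<omega>)) \<in> measurable M (S \<Otimes>\<^sub>M (T \<Otimes>\<^sub>M R))\<close>]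
    by (auto simp: space_pair_measure)
  then have "emeasure M {\<omega> \<in> space M. W \<omega> = d \<and> X \<omega> \<in> B}
      = emeasure (distr M (S \<Otimes>\<^sub>M (T \<Otimes>\<^sub>M R)) (\<lambda>\<omega>. (V \<omega>, W \<omega>, X \<omega>))) ?E"
    using E by (simp add: emeasure_distr)
  also have "\<dots> = (\<integral>\<^sup>+z. (case z of (v, w, x) \<Rightarrow> r x * a (w, x) * k (v, w, x)) * indicator ?E z \<partial>(S \<Otimes>\<^sub>M (T \<Otimes>\<^sub>M R)))"
    unfolding distributed_distr_eq_density[OF VWX] using E by (subst emeasure_density) auto
  also have "\<dots> = (\<integral>\<^sup>+z. (\<integral>\<^sup>+v. (case z of (w, x) \<Rightarrow> r x * a (w, x) * k (v, w, x)) * indicator ?E (v, z) \<partial>S) \<partial>(T \<Otimes>\<^sub>M R))"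
    by (subst STR.nn_integral_snd[symmetric]) auto
  also have "\<dots> = (\<integral>\<^sup>+z. (case z of (w, x) \<Rightarrow> r x * a (w, x) * h (w, x) * indicator {d} w * indicator B x) \<partial>(T \<Otimes>\<^sub>M R))"
  proof (rule nn_integral_cong)
    fix z assume "z \<in> space (T \<Otimes>\<^sub>M R)"
    moreover obtain w x where z: "z = (w, x)" by (cases z)
    ultimately have [measurable]: "w \<in> space T" "x \<in> space R" by (auto simp: space_pair_measure)
    have "(\<integral>\<^sup>+v. r x * a (w, x) * k (v, w, x) * indicator ?E (v, w, x) \<partial>S)
        = (\<integral>\<^sup>+v. (r x * a (w, x) * indicator {d} w * indicator B x) * k (v, w, x) \<partial>S)"
      by (rule nn_integral_cong) (auto simp: indicator_def)
    also have "\<dots> = (r x * a (w, x) * indicator {d} w * indicator B x) * h (w, x)"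
      unfolding h_def by (rule nn_integral_cmult) measurable
    finally show "(\<integral>\<^sup>+v. (case z of (w, x) \<Rightarrow> r x * a (w, x) * k (v, w, x)) * indicator ?E (v, z) \<partial>S)
        = (case z of (w, x) \<Rightarrow> r x * a (w, x) * h (w, x) * indicator {d} w * indicator B x)"
      by (simp add: z ac_simps)
  qed
  also have "\<dots> = (\<integral>\<^sup>+x. (\<integral>\<^sup>+w. r x * a (w, x) * h (w, x) * indicator {d} w * indicator B x \<partial>T) \<partial>R)"
    by (subst TR.nn_integral_snd[symmetric]) auto
  also have "\<dots> = (\<integral>\<^sup>+x. r x * (a (d, x) * emeasure T {d} * h (d, x) * indicator B x) \<partial>R)"
  proof (rule nn_integral_cong)
    fix x
    have "(\<integral>\<^sup>+w. r x * a (w, x) * h (w, x) * indicator {d} w * indicator B x \<partial>T)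
        = (\<integral>\<^sup>+w. (r x * a (d, x) * h (d, x) * indicator B x) * indicator {d} w \<partial>T)"
      by (rule nn_integral_cong) (auto simp: indicator_def)
    also have "\<dots> = r x * a (d, x) * h (d, x) * indicator B x * emeasure T {d}"
      by (rule nn_integral_cmult_indicator[OF d])
    finally show "(\<integral>\<^sup>+w. r x * a (w, x) * h (w, x) * indicator {d} w * indicator B x \<partial>T)
        = r x * (a (d, x) * emeasure T {d} * h (d, x) * indicator B x)"
      by (simp add: ac_simps)
  qed
  \<comment> \<open>Here \<open>r\<close> disappears: integrating against \<open>r\<close> with
    respect to \<open>R\<close> is integrating against the law of \<open>X\<close>.\<close>
  also have "\<dots> = (\<integral>\<^sup>+x. a (d, x) * emeasure T {d} * h (d, x) * indicator B x \<partial>distr M R X)"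
    unfolding distributed_distr_eq_density[OF X] by (subst nn_integral_density) auto
  also have "\<dots> = (\<integral>\<^sup>+\<omega>. a (d, X \<omega>) * emeasure T {d} * h (d, X \<omega>) * indicator B (X \<omega>) \<partial>M)"
    by (subst nn_integral_distr) auto
  also have "\<dots> = (\<integral>\<^sup>+\<omega>\<in>{\<omega> \<in> space M. X \<omega> \<in> B}. a (d, X \<omega>) * emeasure T {d} * h (d, X \<omega>) \<partial>M)"
    by (rule nn_integral_cong) (auto simp: indicator_def)
  finally show ?thesis unfolding h_def .
qed

section \<open>Equality of the propensity scores and comparison of the bounds\<close>

theorem theorem4:
  fixes M :: "'w measure"
    and YT YC Y D :: "'w \<Rightarrow> real"
    and I :: "'w \<Rightarrow> 'i" and U :: "'w \<Rightarrow> 'u" and C :: "'w \<Rightarrow> 'c"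
    and \<mu>Y \<mu>D :: "real measure"
    and \<mu>I :: "'i measure" and \<mu>U :: "'u measure" and \<mu>C :: "'c measure"
    and pI :: "'i \<Rightarrow> ennreal"
    and pUC :: "'u \<times> 'c \<Rightarrow> ennreal"
    and pD :: "real \<times> 'i \<times> 'u \<Rightarrow> ennreal"
    and pY :: "real \<times> real \<times> 'u \<times> 'c \<Rightarrow> ennreal"
    and \<beta> :: real
  assumes "prob_space M"
    and YT: "YT \<in> borel_measurable M" "integrable M (\<lambda>\<omega>. (YT \<omega>)\<^sup>2)"
    and YC: "YC \<in> borel_measurable M" "integrable M (\<lambda>\<omega>. (YC \<omega>)\<^sup>2)"
    and D: "D \<in> borel_measurable M" "\<And>\<omega>. \<omega> \<in> space M \<Longrightarrow> D \<omega> \<in> {0, 1}"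
    and Y: "\<And>\<omega>. Y \<omega> = D \<omega> * YT \<omega> + (1 - D \<omega>) * YC \<omega>"
    and covariates: "I \<in> measurable M \<mu>I" "U \<in> measurable M \<mu>U" "C \<in> measurable M \<mu>C"
    and dominating_measures:
      "sigma_finite_measure \<mu>Y" "sets \<mu>Y = sets borel"
      "sigma_finite_measure \<mu>D" "sets \<mu>D = sets borel"
      "sigma_finite_measure \<mu>I" "sigma_finite_measure \<mu>U" "sigma_finite_measure \<mu>C"
    and unconfoundedness:
      "cond_indep_given M (\<mu>I \<Otimes>\<^sub>M (\<mu>U \<Otimes>\<^sub>M \<mu>C)) (\<lambda>\<omega>. (I \<omega>, U \<omega>, C \<omega>))
         (borel \<Otimes>\<^sub>M borel) (\<lambda>\<omega>. (YT \<omega>, YC \<omega>)) borel D"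
    and overlap:
      "AE \<omega> in M. 0 < propensity M (\<mu>I \<Otimes>\<^sub>M (\<mu>U \<Otimes>\<^sub>M \<mu>C)) (\<lambda>\<omega>. (I \<omega>, U \<omega>, C \<omega>)) D \<omega> \<and>
         propensity M (\<mu>I \<Otimes>\<^sub>M (\<mu>U \<Otimes>\<^sub>M \<mu>C)) (\<lambda>\<omega>. (I \<omega>, U \<omega>, C \<omega>)) D \<omega> < 1"
    and independence:
      "indep_rv M \<mu>I I (\<mu>U \<Otimes>\<^sub>M \<mu>C) (\<lambda>\<omega>. (U \<omega>, C \<omega>))"
    and densities:
      "distributed M \<mu>I I pI"
      "distributed M (\<mu>U \<Otimes>\<^sub>M \<mu>C) (\<lambda>\<omega>. (U \<omega>, C \<omega>)) pUC"
      "cond_density_given M (\<mu>I \<Otimes>\<^sub>M \<mu>U) (\<lambda>\<omega>. (I \<omega>, U \<omega>)) \<mu>D D pD"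
      "cond_density_given M (\<mu>D \<Otimes>\<^sub>M (\<mu>U \<Otimes>\<^sub>M \<mu>C)) (\<lambda>\<omega>. (D \<omega>, U \<omega>, C \<omega>)) \<mu>Y Y pY"
    and factorization:
      "distributed M (\<mu>Y \<Otimes>\<^sub>M (\<mu>D \<Otimes>\<^sub>M (\<mu>I \<Otimes>\<^sub>M (\<mu>U \<Otimes>\<^sub>M \<mu>C))))
         (\<lambda>\<omega>. (Y \<omega>, D \<omega>, I \<omega>, U \<omega>, C \<omega>))
         (\<lambda>(y, d, i, u, c). pI i * pUC (u, c) * pD (d, i, u) * pY (y, d, u, c))"
    and \<beta>: "\<beta> = prob_space.expectation M YT - prob_space.expectation M YC"
  shows "efficiency_bound M (\<mu>I \<Otimes>\<^sub>M \<mu>U) (\<lambda>\<omega>. (I \<omega>, U \<omega>)) YT YC D \<beta>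
       \<ge> efficiency_bound M (\<mu>I \<Otimes>\<^sub>M (\<mu>U \<Otimes>\<^sub>M \<mu>C)) (\<lambda>\<omega>. (I \<omega>, U \<omega>, C \<omega>)) YT YC D \<beta>"
proof -
  interpret prob_space M by fact
  interpret I: sigma_finite_measure \<mu>I by fact
  interpret U: sigma_finite_measure \<mu>U by fact
  interpret C: sigma_finite_measure \<mu>C by fact
  interpret UC: pair_sigma_finite \<mu>U \<mu>C ..
  interpret IUC: pair_sigma_finite \<mu>I "\<mu>U \<Otimes>\<^sub>M \<mu>C" ..
  note [measurable] = YT(1) YC(1) D(1) covariates and [measurable_cong] = dominating_measures(2,4)
  let ?N = "\<mu>I \<Otimes>\<^sub>M (\<mu>U \<Otimes>\<^sub>M \<mu>C)" and ?X = "\<lambda>\<omega>. (I \<omega>, U \<omega>, C \<omega>)"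
  let ?L = "\<mu>I \<Otimes>\<^sub>M \<mu>U" and ?W = "\<lambda>\<omega>. (I \<omega>, U \<omega>)"
  define F where "F = vimage_algebra (space M) ?X ?N"
  define G where "G = vimage_algebra (space M) ?W ?L"
  have [measurable]: "pD \<in> borel_measurable (\<mu>D \<Otimes>\<^sub>M ?L)"
    "pY \<in> borel_measurable (\<mu>Y \<Otimes>\<^sub>M (\<mu>D \<Otimes>\<^sub>M (\<mu>U \<Otimes>\<^sub>M \<mu>C)))"
    using densities(3,4) by (auto simp: cond_density_given_def)
  have X [measurable]: "?X \<in> measurable M ?N" and X0 [measurable]: "?W \<in> measurable M ?L"
    by measurable
  have GF: "subalgebra F G"
    unfolding F_def G_def by (rule subalgebra_vimage_algebra_comp[where T="\<lambda>(i, u, c). (i, u)"]) auto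
  interpret finite_measure_subalgebra M F
    unfolding F_def by unfold_locales (rule subalgebra_vimage_algebra[OF X])
  interpret G: finite_measure_subalgebra M G
    unfolding G_def by unfold_locales (rule subalgebra_vimage_algebra[OF X0])

  interpret Y: sigma_finite_measure \<mu>Y by fact
  \<comment> \<open>\<open>q\<close> is the candidate for the common propensity score: a density at
    1 becomes a probability after multiplication by the mass that \<open>\<mu>D\<close> gives to the
    point 1.\<close>
  define q where "q = (\<lambda>(i, u). pD (1, i, u) * emeasure \<mu>D {1})"
  define h where "h = (\<lambda>(d, u, c). \<integral>\<^sup>+y. pY (y, d, u, c) \<partial>\<mu>Y)"
  have one [measurable]: "1 \<in> space \<mu>D" "{1} \<in> sets \<mu>D"
    using sets_eq_imp_space_eq[OF dominating_measures(4)] dominating_measures(4) by auto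
  have q [measurable]: "q \<in> borel_measurable ?L" unfolding q_def by measurable
  have h [measurable]: "h \<in> borel_measurable (\<mu>D \<Otimes>\<^sub>M (\<mu>U \<Otimes>\<^sub>M \<mu>C))" unfolding h_def by measurable
  define g where "g = (\<lambda>(i, u, c). q (i, u) * h (1, u, c))"
  have g [measurable]: "g \<in> borel_measurable ?N" unfolding g_def by measurable
  define E where "E = {\<omega> \<in> space M. D \<omega> = 1}"
  have E [measurable]: "E \<in> sets M" unfolding E_def by measurable

  have PX: "distributed M ?N ?X (\<lambda>(i, uc). pI i * pUC uc)"
    by (rule distributed_Pair_indep_rv[OF \<open>prob_space M\<close>])
       (use densities(1,2) independence in \<open>auto intro: I.sigma_finite_measure_axioms UC.P.sigma_finite_measure_axioms\<close>)
  have ED: "emeasure M {\<omega> \<in> space M. D \<omega> = 1 \<and> ?X \<omega> \<in> B} = (\<integral>\<^sup>+\<omega>\<in>{\<omega> \<in> space M. ?X \<omega> \<in> B}. g (?X \<omega>) \<partial>M)"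
    if "B \<in> sets ?N" for B
  proof -
    \<comment> \<open>The factorization regrouped with all covariates as one variable, so that its
      first two factors form the density \<open>PX\<close>.\<close>
    have "distributed M (\<mu>Y \<Otimes>\<^sub>M (\<mu>D \<Otimes>\<^sub>M ?N)) (\<lambda>\<omega>. (Y \<omega>, D \<omega>, ?X \<omega>))
      (\<lambda>(y, d, x). (case x of (i, uc) \<Rightarrow> pI i * pUC uc)
        * (case (d, x) of (d, i, u, c) \<Rightarrow> pD (d, i, u)) * (case (y, d, x) of (y, d, i, u, c) \<Rightarrow> pY (y, d, u, c)))"
      using factorization by (simp add: case_prod_unfold)
    from emeasure_factorized_density[OF dominating_measures(1,3) IUC.P.sigma_finite_measure_axioms this PX _ _ one(2) that]
    show ?thesis
      by (simp add: g_def q_def h_def)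
  qed
  have EF: "emeasure M (E \<inter> A) = (\<integral>\<^sup>+\<omega>\<in>A. g (?X \<omega>) \<partial>M)" if mem: "A \<in> sets F" for A
  proof -
    obtain B where B: "B \<in> sets ?N" and A: "A = {\<omega> \<in> space M. ?X \<omega> \<in> B}"
      using mem X unfolding F_def by (rule sets_vimage_algebraE)
    have "E \<inter> A = {\<omega> \<in> space M. D \<omega> = 1 \<and> ?X \<omega> \<in> B}" by (auto simp: E_def A)
    then show ?thesis unfolding A using ED[OF B] by simp
  qed
  define p where "p = real_cond_exp M F (indicator E)"
  define p0 where "p0 = real_cond_exp M G (indicator E)"
  have gF: "(\<lambda>\<omega>. g (?X \<omega>)) \<in> borel_measurable F"
    unfolding F_def by (rule measurable_vimage_algebra_comp[OF X g])
  have pg: "AE \<omega> in M. p \<omega> = enn2real (g (?X \<omega>))"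
    unfolding p_def by (rule real_cond_exp_indicator_eq[OF E gF EF])
  have p01: "AE \<omega> in M. 0 < p \<omega> \<and> p \<omega> < 1"
    using overlap unfolding propensity_def cond_prob_given_def cond_exp_given_def p_def F_def E_def .

  \<comment> \<open>The mass is known only at the realized value of \<open>D\<close>, so at the
    argument 1 this speaks only about \<open>E\<close>.\<close>
  have "AE \<omega> in M. h (D \<omega>, U \<omega>, C \<omega>) = 1"
    using AE_cond_density_given_nn_integral[OF \<open>prob_space M\<close> dominating_measures(1) densities(4)]
    by (simp add: h_def)
  define A where "A = {\<omega> \<in> space M. h (1, U \<omega>, C \<omega>) \<noteq> 1}"
  \<comment> \<open>Written as a function of \<open>?X\<close> to place \<open>A\<close> in
    \<open>F\<close>, where \<open>EF\<close> applies.\<close>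
  have "(\<lambda>\<omega>. (case ?X \<omega> of (i, u, c) \<Rightarrow> h (1, u, c))) \<in> borel_measurable F"
    unfolding F_def by (rule measurable_vimage_algebra_comp[OF X]) measurable
  then have "{\<omega> \<in> space F. h (1, U \<omega>, C \<omega>) \<noteq> 1} \<in> sets F"
    by simp
  then have AF: "A \<in> sets F"
    using subalg by (simp add: A_def subalgebra_def)
  then have [measurable]: "A \<in> sets M" using subalg by (auto simp: subalgebra_def)
  \<comment> \<open>\<open>A\<close> is determined by \<open>X\<close> and almost surely misses \<open>{D = 1}\<close>, so \<open>p\<close> vanishes on it;
    overlap makes it null.\<close>
  have "AE \<omega> in M. \<omega> \<notin> E \<inter> A"
    using \<open>AE \<omega> in M. h (D \<omega>, U \<omega>, C \<omega>) = 1\<close> by eventually_elim (auto simp: E_def A_def)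
  then have "emeasure M (E \<inter> A) = 0"
    by (subst (asm) AE_iff_measurable[of "E \<inter> A"]) (auto simp: E_def)
  then have "(\<integral>\<^sup>+\<omega>\<in>A. g (?X \<omega>) \<partial>M) = 0"
    using EF[OF AF] by simp
  then have "AE \<omega> in M. g (?X \<omega>) * indicator A \<omega> = 0"
    by (subst (asm) nn_integral_0_iff_AE) auto
  with pg p01 have "AE \<omega> in M. \<omega> \<notin> A"
    by eventually_elim (auto simp: indicator_def)
  with pg AE_space have pq: "AE \<omega> in M. p \<omega> = enn2real (q (?W \<omega>))"
    by eventually_elim (simp add: A_def g_def)

  have qG [measurable]: "(\<lambda>\<omega>. enn2real (q (?W \<omega>))) \<in> borel_measurable G"
    unfolding G_def by (rule measurable_vimage_algebra_comp[OF X0]) measurable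
  have pi: "integrable M p"
    unfolding p_def by (rule real_cond_exp_int) (auto simp: emeasure_eq_measure)
  then have qi: "integrable M (\<lambda>\<omega>. enn2real (q (?W \<omega>)))"
    using pq by (subst integrable_cong_AE[where g=p]) auto
  \<comment> \<open>By the tower property \<open>p0\<close> is the conditional expectation of
    \<open>p\<close> given \<open>G\<close>; as \<open>p\<close> agrees almost surely with a
    \<open>G\<close>-measurable function, this conditioning leaves it unchanged.\<close>
  have "AE \<omega> in M. real_cond_exp M G p \<omega> = p0 \<omega>"
    unfolding p_def p0_def by (rule G.real_cond_exp_nested_subalg[OF subalg GF]) (auto simp: emeasure_eq_measure)
  moreover have "AE \<omega> in M. real_cond_exp M G p \<omega> = real_cond_exp M G (\<lambda>\<omega>. enn2real (q (?W \<omega>))) \<omega>"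
    using pq pi qi by (intro G.real_cond_exp_cong) auto
  moreover have "AE \<omega> in M. real_cond_exp M G (\<lambda>\<omega>. enn2real (q (?W \<omega>))) \<omega> = enn2real (q (?W \<omega>))"
    using qi qG by (rule G.real_cond_exp_F_meas)
  ultimately have pp0: "AE \<omega> in M. p \<omega> = p0 \<omega>"
    using pq by eventually_elim simp
  have p0G: "p0 \<in> borel_measurable G" unfolding p0_def by simp
  have p001: "AE \<omega> in M. 0 < p0 \<omega> \<and> p0 \<omega> < 1"
    using p01 pp0 by eventually_elim simp

  \<comment> \<open>Replacing \<open>p\<close> by \<open>p0\<close> gives both bounds the same
    \<open>G\<close>-measurable denominators, as the monotonicity lemma requires.\<close>
  have "efficiency_bound M ?N ?X YT YC D \<beta> = (\<integral>\<^sup>+\<omega>. ennreal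
        (real_cond_exp M F (\<lambda>\<omega>. (YT \<omega> - real_cond_exp M F YT \<omega>)\<^sup>2) \<omega> / p0 \<omega>
         + real_cond_exp M F (\<lambda>\<omega>. (YC \<omega> - real_cond_exp M F YC \<omega>)\<^sup>2) \<omega> / (1 - p0 \<omega>)
         + (real_cond_exp M F YT \<omega> - real_cond_exp M F YC \<omega> - \<beta>)\<^sup>2) \<partial>M)"
    unfolding efficiency_bound_def cond_var_given_def cond_effect_def propensity_def cond_prob_given_def
      cond_exp_given_def F_def[symmetric] E_def[symmetric] p_def[symmetric]
    by (rule nn_integral_cong_AE) (use pp0 in \<open>eventually_elim, simp\<close>)
  also have "\<dots> \<le> efficiency_bound M ?L ?W YT YC D \<beta>"
    using nn_integral_efficiency_bound_mono[OF GF YT(1) YC(1) YT(2) YC(2) p0G p001, of \<beta>]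
    unfolding efficiency_bound_def cond_var_given_def cond_effect_def propensity_def cond_prob_given_def
      cond_exp_given_def G_def[symmetric] E_def[symmetric] p0_def[symmetric] .
  finally show ?thesis .
qed

end
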